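(* Let $A$ be a commutative ring with nonzero identity and $I$ a proper ideal of $A$. (i) $I$ is a classical 1-absorbing prime submodule of the $A$-module $A$ if and only if $I$ is a 1-absorbing prime ideal of $A$. (ii) The following are equivalent: (a) for every $A$-module $M$, every proper submodule $P$ of $M$ is a classical 1-absorbing prime submodule of $M$; (b) $A$ is a local ring with unique maximal ideal $\mathfrak{m}$ such that $\mathfrak{m}^{2}=(0)$.
   Context: All rings are commutative with nonzero identity; modules are nonzero and unital. A ring is called local if it has a unique maximal ideal (no Noetherian hypothesis). A proper submodule $P$ of an $A$-module $M$ is a classical 1-absorbing prime submodule if whenever $abcm\in P$ for nonunits $a,b,c\in A$ and $m\in M$, then $abm\in P$ or $cm\in P$. A proper ideal $I$ of $A$ is a 1-absorbing prime ideal if whenever $abc\in I$ for nonunits $a,b,c\in A$, then $ab\in I$ or $c\in I$. *)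

theory Defs
  imports "HOL-Algebra.Algebra"
begin

definition nonunits :: "('a, 'r) ring_scheme \<Rightarrow> 'a set"
  where "nonunits A = carrier A - Units A"

definition classical_1_absorbing_prime_submodule ::
    "'b set \<Rightarrow> ('a, 'r) ring_scheme \<Rightarrow> ('a, 'b, 'm) module_scheme \<Rightarrow> bool"
  where "classical_1_absorbing_prime_submodule P A M \<longleftrightarrow>
    submodule P A M \<and> P \<noteq> carrier M \<and>
    (\<forall>a \<in> nonunits A. \<forall>b \<in> nonunits A. \<forall>c \<in> nonunits A. \<forall>x \<in> carrier M.
       (a \<otimes>\<^bsub>A\<^esub> b \<otimes>\<^bsub>A\<^esub> c) \<odot>\<^bsub>M\<^esub> x \<in> P \<longrightarrow>
       (a \<otimes>\<^bsub>A\<^esub> b) \<odot>\<^bsub>M\<^esub> x \<in> P \<or> c \<odot>\<^bsub>M\<^esub> x \<in> P)"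

definition one_absorbing_prime_ideal :: "'a set \<Rightarrow> ('a, 'r) ring_scheme \<Rightarrow> bool"
  where "one_absorbing_prime_ideal I A \<longleftrightarrow>
    ideal I A \<and> I \<noteq> carrier A \<and>
    (\<forall>a \<in> nonunits A. \<forall>b \<in> nonunits A. \<forall>c \<in> nonunits A.
       a \<otimes>\<^bsub>A\<^esub> b \<otimes>\<^bsub>A\<^esub> c \<in> I \<longrightarrow> a \<otimes>\<^bsub>A\<^esub> b \<in> I \<or> c \<in> I)"

definition self_module :: "('a, 'r) ring_scheme \<Rightarrow> ('a, 'a) module"
  where "self_module A =
    \<lparr>carrier = carrier A, monoid.mult = (\<otimes>\<^bsub>A\<^esub>), one = \<one>\<^bsub>A\<^esub>,
     ring.zero = \<zero>\<^bsub>A\<^esub>, add = (\<oplus>\<^bsub>A\<^esub>), smult = (\<otimes>\<^bsub>A\<^esub>)\<rparr>"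

text \<open>
  A formula cannot quantify over types, so the carrier type of the modules is a parameter,
  passed as an \<open>itself\<close> argument.
  Within that type the carrier set and the operations are arbitrary.
  Over a type too small to carry a nonzero \<open>A\<close>-module the condition holds vacuously, so
  ``all modules'' is to be read as the condition at the type of \<open>A\<close> together with the
  condition at a further, arbitrary type.
\<close>

definition all_proper_submodules_classical ::
    "('a, 'r) ring_scheme \<Rightarrow> 'b itself \<Rightarrow> bool"
  where "all_proper_submodules_classical A (_ :: 'b itself) \<longleftrightarrow>
    (\<forall>M :: ('a, 'b) module. module A M \<and> carrier M \<noteq> {\<zero>\<^bsub>M\<^esub>} \<longrightarrow>
       (\<forall>P. submodule P A M \<and> P \<noteq> carrier M \<longrightarrow>
          classical_1_absorbing_prime_submodule P A M))"

definition local_ring_with_maximal_ideal :: "('a, 'r) ring_scheme \<Rightarrow> 'a set \<Rightarrow> bool"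
  where "local_ring_with_maximal_ideal A \<mm> \<longleftrightarrow>
    cring A \<and> maximalideal \<mm> A \<and> (\<forall>J. maximalideal J A \<longrightarrow> J = \<mm>)"

lemma self_module_simps [simp]:
  "carrier (self_module A) = carrier A"
  "\<zero>\<^bsub>self_module A\<^esub> = \<zero>\<^bsub>A\<^esub>"
  "(\<oplus>\<^bsub>self_module A\<^esub>) = (\<oplus>\<^bsub>A\<^esub>)"
  "(\<odot>\<^bsub>self_module A\<^esub>) = (\<otimes>\<^bsub>A\<^esub>)"
  by (simp_all add: self_module_def)

lemma module_self_module:
  assumes "cring A"
  shows "module A (self_module A)"
proof -
  interpret cring A by fact
  show ?thesis
  proof (rule moduleI)
    show "abelian_group (self_module A)"
      by (rule abelian_groupI) (auto simp: a_ac intro: l_neg)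
  qed (auto simp: l_distr r_distr m_assoc assms)
qed

lemma submodule_self_module_iff_ideal:
  assumes "cring A"
  shows "submodule I A (self_module A) \<longleftrightarrow> ideal I A"
proof -
  interpret cring A by fact
  show ?thesis
  proof
    assume I: "submodule I A (self_module A)"
    have sub: "subgroup I (add_monoid A)"
      using submodule.axioms(1)[OF I] by (simp add: subgroup_def m_inv_def)
    have l: "x \<otimes>\<^bsub>A\<^esub> a \<in> I" if "a \<in> I" "x \<in> carrier A" for a x
      using submodule.smult_closed[OF I that(2,1)] by simp
    moreover have "a \<otimes>\<^bsub>A\<^esub> x \<in> I" if "a \<in> I" "x \<in> carrier A" for a x
      using l[OF that] subgroup.subset[OF sub] that m_comm[of a x] by auto
    ultimately show "ideal I A"
      by (intro idealI[OF ring_axioms sub])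
  next
    assume "ideal I A"
    then interpret ideal I A .
    show "submodule I A (self_module A)"
      by (use a_subgroup in \<open>auto simp: submodule_def submodule_axioms_def subgroup_def
          m_inv_def I_l_closed\<close>)
  qed
qed

end

theory Submission
  imports Defs
begin

text \<open>
  For the self-module, the extra factor \<open>x\<close> of the module condition can be absorbed into the
  nonunit \<open>c\<close>, because \<open>c \<otimes> x\<close> is again a nonunit; conversely \<open>x = \<one>\<close> recovers the ideal
  condition.

  For the second part, apply the condition for all modules to the self-module, that is, to
  the proper ideals of the ring.  The instructive ideals are \<open>(a b c)\<close> with \<open>a\<close>, \<open>b\<close>, \<open>c\<close>
  nonunits: each of them contains \<open>a b\<close> or \<open>c\<close> (\<open>absorbing_dichotomy\<close>).
  If two nonunits had \<open>a + b = \<one>\<close>, then \<open>(a a b)\<close> would contain \<open>a\<^sup>2\<close> or \<open>b\<close>.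
  In the first case \<open>b\<close> divides \<open>a\<^sup>2\<close>, hence also \<open>a (a + b) + b = \<one>\<close>; in the second \<open>a\<close>
  divides \<open>b\<close>, hence also \<open>a + b = \<one>\<close>; both are absurd.
  So the sum of two nonunits is a nonunit, the nonunits form an ideal, and this
  ideal is the only maximal one.
  The dichotomy now says that \<open>a b\<close> or \<open>c\<close> is a multiple of itself by a nonunit and, by
  cancelling the unit \<open>\<one> - n\<close>, vanishes; taking \<open>c = a\<close> gives \<open>a b = \<zero>\<close> in either
  case.

  Conversely, if \<open>\<mm>\<^sup>2 = (\<zero>)\<close> then every nonunit lies in the maximal ideal \<open>\<mm>\<close>: otherwise
  \<open>\<one> = i + x\<close> with \<open>i \<in> \<mm>\<close> and \<open>x\<close> a multiple of the nonunit, although \<open>i\<^sup>2 = \<zero>\<close> makes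
  \<open>\<one> - i\<close> a unit.
  Products of two nonunits are therefore zero, and \<open>(a b) x = \<zero>\<close> lies in every submodule.
\<close>

section \<open>Nonunits and the self-module\<close>

context cring
begin

lemma nonunit_mult_closed:
  assumes "x \<in> nonunits R" "y \<in> carrier R"
  shows "x \<otimes> y \<in> nonunits R" "y \<otimes> x \<in> nonunits R"
  using assms unit_factor[of x y] m_comm[of x y] by (auto simp: nonunits_def)

lemma proper_cgenideal:
  assumes "x \<in> nonunits R"
  shows "PIdl x \<noteq> carrier R"
proof
  assume "PIdl x = carrier R"
  then have "\<one> \<in> PIdl x" by simp
  then obtain r where "r \<in> carrier R" "r \<otimes> x = \<one>" by (auto simp: cgenideal_def)
  then show False
    using nonunit_mult_closed(2)[OF assms] by (force simp: nonunits_def)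
qed

lemma classical_self_module_iff:
  assumes "ideal I R" "I \<noteq> carrier R"
  shows "classical_1_absorbing_prime_submodule I R (self_module R) \<longleftrightarrow>
         one_absorbing_prime_ideal I R" (is "?L \<longleftrightarrow> ?R")
proof
  assume L: ?L
  show ?R
    unfolding one_absorbing_prime_ideal_def
  proof (intro conjI ballI impI assms)
    fix a b c
    assume nu: "a \<in> nonunits R" "b \<in> nonunits R" "c \<in> nonunits R"
      and abc: "a \<otimes> b \<otimes> c \<in> I"
    have carr: "a \<in> carrier R" "b \<in> carrier R" "c \<in> carrier R"
      using nu by (auto simp: nonunits_def)
    have "(a \<otimes> b) \<otimes> \<one> \<in> I \<or> c \<otimes> \<one> \<in> I"
      using L nu abc carr unfolding classical_1_absorbing_prime_submodule_def
      by (metis self_module_simps(1,4) one_closed r_one m_closed)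
    then show "a \<otimes> b \<in> I \<or> c \<in> I" using carr by simp
  qed
next
  assume R: ?R
  have "(a \<otimes> b) \<otimes> x \<in> I \<or> c \<otimes> x \<in> I"
    if nu: "a \<in> nonunits R" "b \<in> nonunits R" "c \<in> nonunits R" and x: "x \<in> carrier R"
      and abcx: "(a \<otimes> b \<otimes> c) \<otimes> x \<in> I" for a b c x
  proof -
    have carr: "a \<in> carrier R" "b \<in> carrier R" "c \<in> carrier R"
      using nu by (auto simp: nonunits_def)
    have "a \<otimes> b \<otimes> (c \<otimes> x) \<in> I" using abcx carr x by (simp add: m_assoc)
    then have "a \<otimes> b \<in> I \<or> c \<otimes> x \<in> I"
      using R nu nonunit_mult_closed(1)[OF nu(3) x]
      unfolding one_absorbing_prime_ideal_def by blast
    then show ?thesis using ideal.I_r_closed[OF assms(1) _ x] by blast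
  qed
  then show ?L
    using assms submodule_self_module_iff_ideal[OF is_cring]
    unfolding classical_1_absorbing_prime_submodule_def by simp
qed

section \<open>Rings in which every proper ideal is 1-absorbing prime\<close>

text \<open>
  The ideal \<open>(a b c)\<close> contains \<open>a b c\<close> by construction and is proper because its
  generator is a nonunit, so the absorbing property applies to it.  Being principal, it
  turns membership into an equation.
\<close>

lemma absorbing_dichotomy:
  assumes absorbing: "\<And>I. ideal I R \<Longrightarrow> I \<noteq> carrier R \<Longrightarrow> one_absorbing_prime_ideal I R"
    and nu: "a \<in> nonunits R" "b \<in> nonunits R" "c \<in> nonunits R"
  shows "(\<exists>r \<in> carrier R. a \<otimes> b = r \<otimes> (a \<otimes> b \<otimes> c)) \<or>
         (\<exists>r \<in> carrier R. c = r \<otimes> (a \<otimes> b \<otimes> c))"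
proof -
  let ?I = "PIdl (a \<otimes> b \<otimes> c)"
  have carr: "a \<in> carrier R" "b \<in> carrier R" "c \<in> carrier R"
    using nu by (auto simp: nonunits_def)
  have "a \<otimes> b \<otimes> c \<in> nonunits R"
    by (intro nonunit_mult_closed(2) nu m_closed carr)
  then have "one_absorbing_prime_ideal ?I R"
    by (intro absorbing cgenideal_ideal proper_cgenideal m_closed carr)
  then have "a \<otimes> b \<in> ?I \<or> c \<in> ?I"
    using nu cgenideal_self[of "a \<otimes> b \<otimes> c"] carr
    unfolding one_absorbing_prime_ideal_def by auto
  then show ?thesis unfolding cgenideal_def by blast
qed

text \<open>
  The dichotomy is applied to \<open>a a b\<close>: this is the place where two distinct maximal
  ideals, one containing \<open>a\<close> and one containing \<open>b\<close>, would be separated.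
\<close>

lemma nonunits_not_comaximal:
  assumes absorbing: "\<And>I. ideal I R \<Longrightarrow> I \<noteq> carrier R \<Longrightarrow> one_absorbing_prime_ideal I R"
    and nu: "a \<in> nonunits R" "b \<in> nonunits R"
  shows "a \<oplus> b \<noteq> \<one>"
proof
  assume one: "a \<oplus> b = \<one>"
  have carr: "a \<in> carrier R" "b \<in> carrier R"
    using nu by (auto simp: nonunits_def)
  consider
    (1) r where "r \<in> carrier R" "a \<otimes> a = r \<otimes> (a \<otimes> a \<otimes> b)"
  | (2) r where "r \<in> carrier R" "b = r \<otimes> (a \<otimes> a \<otimes> b)"
    using absorbing_dichotomy[OF absorbing nu(1) nu(1) nu(2)] by blast
  then show False
  proof cases
    case (1 r)
    have "\<one> = a \<otimes> (a \<oplus> b) \<oplus> b" using one carr by simp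
    also have "\<dots> = a \<otimes> a \<oplus> a \<otimes> b \<oplus> b" using carr by (simp add: r_distr)
    also have "\<dots> = r \<otimes> (a \<otimes> a \<otimes> b) \<oplus> a \<otimes> b \<oplus> b" by (simp flip: 1(2))
    also have "\<dots> = b \<otimes> (r \<otimes> (a \<otimes> a) \<oplus> a \<oplus> \<one>)" using carr 1(1) by algebra
    finally show False
      using nonunit_mult_closed(1)[OF nu(2), of "r \<otimes> (a \<otimes> a) \<oplus> a \<oplus> \<one>"] carr 1(1)
      by (auto simp: nonunits_def)
  next
    case (2 r)
    have "\<one> = a \<oplus> r \<otimes> (a \<otimes> a \<otimes> b)" using one by (simp flip: 2(2))
    also have "\<dots> = a \<otimes> (\<one> \<oplus> r \<otimes> (a \<otimes> b))" using carr 2(1) by algebra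
    finally show False
      using nonunit_mult_closed(1)[OF nu(1), of "\<one> \<oplus> r \<otimes> (a \<otimes> b)"] carr 2(1)
      by (auto simp: nonunits_def)
  qed
qed

text \<open>
  Excluding the sum \<open>\<one>\<close> excludes every unit \<open>u\<close> as a sum \<open>a + b\<close>: divide by \<open>u\<close>, which
  keeps the two summands nonunits.
\<close>

lemma ideal_nonunits:
  assumes nontrivial: "\<one> \<noteq> \<zero>"
    and not_comaximal: "\<And>a b. a \<in> nonunits R \<Longrightarrow> b \<in> nonunits R \<Longrightarrow> a \<oplus> b \<noteq> \<one>"
  shows "ideal (nonunits R) R"
proof (rule idealI[OF ring_axioms])
  have add: "a \<oplus> b \<in> nonunits R" if nu: "a \<in> nonunits R" "b \<in> nonunits R" for a b
  proof (rule ccontr)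
    assume "a \<oplus> b \<notin> nonunits R"
    moreover have carr: "a \<in> carrier R" "b \<in> carrier R"
      using nu by (auto simp: nonunits_def)
    ultimately have u: "a \<oplus> b \<in> Units R" by (simp add: nonunits_def)
    let ?u = "inv (a \<oplus> b)"
    have "?u \<otimes> a \<oplus> ?u \<otimes> b = \<one>" using u carr by (simp flip: r_distr)
    then show False
      using not_comaximal nonunit_mult_closed(2) nu Units_inv_closed[OF u] by blast
  qed
  show "subgroup (nonunits R) (add_monoid R)"
  proof (rule add.subgroupI)
    show "nonunits R \<subseteq> carrier R" by (auto simp: nonunits_def)
    have "\<zero> \<notin> Units R" using nontrivial by (metis Units_l_inv Units_inv_closed r_null)
    then show "nonunits R \<noteq> {}" by (auto simp: nonunits_def)
  next
    fix a assume nu: "a \<in> nonunits R"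
    then have "a \<in> carrier R" by (auto simp: nonunits_def)
    then have "\<ominus> a = (\<ominus> \<one>) \<otimes> a" by algebra
    then show "\<ominus> a \<in> nonunits R" using nonunit_mult_closed(2)[OF nu, of "\<ominus> \<one>"] by simp
  qed (rule add)
qed (auto intro: nonunit_mult_closed)

lemma local_ring_nonunits:
  assumes "ideal (nonunits R) R"
  shows "local_ring_with_maximal_ideal R (nonunits R)"
proof -
  have proper: "nonunits R \<noteq> carrier R" by (auto simp: nonunits_def)
  have below: "J \<subseteq> nonunits R" if J: "ideal J R" "J \<noteq> carrier R" for J
  proof
    fix x assume x: "x \<in> J"
    have xc: "x \<in> carrier R" using ideal.Icarr[OF J(1) x] .
    have "x \<notin> Units R"
    proof
      assume u: "x \<in> Units R"
      then have "inv x \<otimes> x \<in> J" using ideal.I_l_closed[OF J(1) x] by blast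
      then show False using ideal.one_imp_carrier[OF J(1)] J(2) u by simp
    qed
    then show "x \<in> nonunits R" using xc by (simp add: nonunits_def)
  qed
  have max: "maximalideal (nonunits R) R"
    using assms proper below by (intro maximalidealI) auto
  have "J = nonunits R" if "maximalideal J R" for J
  proof -
    interpret J: maximalideal J R by fact
    have "J \<subseteq> nonunits R" using below J.is_ideal J.I_notcarr by auto
    then show ?thesis
      using J.I_maximal[OF assms] proper by (auto simp: nonunits_def)
  qed
  then show ?thesis
    using max is_cring unfolding local_ring_with_maximal_ideal_def by blast
qed

text \<open>
  The case of Nakayama's lemma needed here: \<open>\<one> - n\<close> is a unit, since otherwise \<open>n\<close>
  and \<open>\<one> - n\<close> would be nonunits with sum \<open>\<one>\<close>.
\<close>

lemma eq_nonunit_multiple_imp_zero: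
  assumes not_comaximal: "\<And>a b. a \<in> nonunits R \<Longrightarrow> b \<in> nonunits R \<Longrightarrow> a \<oplus> b \<noteq> \<one>"
    and n: "n \<in> nonunits R" and x: "x \<in> carrier R" and eq: "x = n \<otimes> x"
  shows "x = \<zero>"
proof -
  have nc: "n \<in> carrier R" using n by (simp add: nonunits_def)
  have "n \<oplus> (\<one> \<ominus> n) = \<one>" using nc by algebra
  then have "\<one> \<ominus> n \<notin> nonunits R" using not_comaximal n by blast
  then have u: "\<one> \<ominus> n \<in> Units R" using nc by (simp add: nonunits_def)
  have "(\<one> \<ominus> n) \<otimes> x = x \<ominus> n \<otimes> x" using nc x by algebra
  also have "\<dots> = \<zero>" using x unfolding eq[symmetric] by algebra
  finally have "(\<one> \<ominus> n) \<otimes> x = (\<one> \<ominus> n) \<otimes> \<zero>" using nc by simp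
  then show ?thesis using Units_l_cancel[OF u x zero_closed] by simp
qed

lemma nonunits_mult_eq_zero:
  assumes absorbing: "\<And>I. ideal I R \<Longrightarrow> I \<noteq> carrier R \<Longrightarrow> one_absorbing_prime_ideal I R"
    and nu: "a \<in> nonunits R" "b \<in> nonunits R"
  shows "a \<otimes> b = \<zero>"
proof -
  have "x \<oplus> y \<noteq> \<one>" if "x \<in> nonunits R" "y \<in> nonunits R" for x y
    using nonunits_not_comaximal[OF absorbing that] .
  note vanish = eq_nonunit_multiple_imp_zero[OF this]
  have carr: "a \<in> carrier R" "b \<in> carrier R"
    using nu by (auto simp: nonunits_def)
  consider
    (1) r where "r \<in> carrier R" "a \<otimes> b = r \<otimes> (a \<otimes> b \<otimes> a)"
  | (2) r where "r \<in> carrier R" "a = r \<otimes> (a \<otimes> b \<otimes> a)"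
    using absorbing_dichotomy[OF absorbing nu(1) nu(2) nu(1)] by blast
  then show ?thesis
  proof cases
    case (1 r)
    have "a \<otimes> b = r \<otimes> (a \<otimes> b \<otimes> a)" by (fact 1(2))
    also have "\<dots> = (r \<otimes> a) \<otimes> (a \<otimes> b)" using carr 1(1) by algebra
    finally show ?thesis
      by (intro vanish[of "r \<otimes> a" "a \<otimes> b"] nonunit_mult_closed(2) nu 1(1) m_closed carr)
  next
    case (2 r)
    have "a = r \<otimes> (a \<otimes> b \<otimes> a)" by (fact 2(2))
    also have "\<dots> = (r \<otimes> a \<otimes> b) \<otimes> a" using carr 2(1) by algebra
    finally have "a = \<zero>"
      using nonunit_mult_closed(2)[OF nu(2), of "r \<otimes> a"] carr 2(1)
      by (intro vanish[of "r \<otimes> a \<otimes> b" a]) auto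
    then show ?thesis using carr by simp
  qed
qed

section \<open>Local rings whose maximal ideal has square zero\<close>

text \<open>
  If \<open>a \<notin> \<mm>\<close>, maximality gives \<open>\<mm> + (a) = (\<one>)\<close>, so \<open>a\<close> divides some \<open>\<one> - i\<close> with
  \<open>i \<in> \<mm>\<close>, and such an element is a unit because \<open>i\<close> is nilpotent.
\<close>

lemma nonunits_subset_square_zero_maximalideal:
  assumes "maximalideal \<mm> R" and square: "ideal_prod R \<mm> \<mm> = {\<zero>}"
  shows "nonunits R \<subseteq> \<mm>"
proof
  fix a assume nu: "a \<in> nonunits R"
  then have ac: "a \<in> carrier R" by (simp add: nonunits_def)
  interpret \<mm>: maximalideal \<mm> R by fact
  show "a \<in> \<mm>"
  proof (rule ccontr)
    assume "a \<notin> \<mm>"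
    let ?J = "\<mm> <+>\<^bsub>R\<^esub> PIdl a"
    have J: "ideal ?J R" by (intro add_ideals \<mm>.is_ideal cgenideal_ideal ac)
    have sum: "i \<oplus> y \<in> ?J" if "i \<in> \<mm>" "y \<in> PIdl a" for i y
      using that by (auto simp: set_add_def')
    have "\<zero> \<in> PIdl a"
      using additive_subgroup.zero_closed[OF ideal.axioms(1)[OF cgenideal_ideal[OF ac]]] .
    then have "i \<in> ?J" if "i \<in> \<mm>" for i
      using sum[OF that] \<mm>.Icarr[OF that] by (metis r_zero)
    moreover have "a \<in> ?J"
      using sum[OF \<mm>.zero_closed cgenideal_self[OF ac]] ac by simp
    ultimately have "?J = carrier R"
      using \<mm>.I_maximal[OF J] ideal.Icarr[OF J] \<open>a \<notin> \<mm>\<close> by blast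
    then have "\<one> \<in> ?J" by simp
    then obtain i r where ir: "i \<in> \<mm>" "r \<in> carrier R" "\<one> = i \<oplus> r \<otimes> a"
      by (auto simp: set_add_def' cgenideal_def)
    have ic: "i \<in> carrier R" using \<mm>.Icarr ir(1) by blast
    have "i \<otimes> i = \<zero>" using ideal_prod.prod[OF ir(1) ir(1), of R] square by simp
    \<comment> \<open>\<open>(\<one> - i) (\<one> + i) = \<one> - i\<^sup>2 = \<one>\<close>, and \<open>\<one> - i\<close> is the multiple \<open>r a\<close> of \<open>a\<close>.\<close>
    have ra: "r \<otimes> a = \<one> \<ominus> i"
    proof -
      have "r \<otimes> a = (i \<oplus> r \<otimes> a) \<ominus> i" using ic ac ir(2) by algebra
      then show ?thesis by (simp flip: ir(3))
    qed
    have "a \<otimes> (r \<otimes> (\<one> \<oplus> i)) = (r \<otimes> a) \<otimes> (\<one> \<oplus> i)" using ic ac ir(2) by algebra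
    also have "\<dots> = \<one> \<ominus> i \<otimes> i" unfolding ra using ic by algebra
    also have "\<dots> = \<one>" unfolding \<open>i \<otimes> i = \<zero>\<close> by algebra
    finally show False
      using nonunit_mult_closed(1)[OF nu, of "r \<otimes> (\<one> \<oplus> i)"] ic ir(2)
      by (auto simp: nonunits_def)
  qed
qed

section \<open>The condition for all modules\<close>

lemma all_proper_submodules_classical_imp_ideals:
  fixes I :: "'a set"
  assumes "\<one> \<noteq> \<zero>" and classical: "all_proper_submodules_classical R TYPE('a)"
    and I: "ideal I R" "I \<noteq> carrier R"
  shows "one_absorbing_prime_ideal I R"
proof -
  have "carrier (self_module R) \<noteq> {\<zero>\<^bsub>self_module R\<^esub>}"
    using \<open>\<one> \<noteq> \<zero>\<close> by auto
  then have "classical_1_absorbing_prime_submodule I R (self_module R)"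
    using classical module_self_module[OF is_cring] I
      submodule_self_module_iff_ideal[OF is_cring]
    unfolding all_proper_submodules_classical_def by simp
  then show ?thesis using classical_self_module_iff[OF I] by simp
qed

lemma square_zero_local_imp_all_classical:
  assumes "local_ring_with_maximal_ideal R \<mm>" and square: "ideal_prod R \<mm> \<mm> = {\<zero>}"
  shows "all_proper_submodules_classical R TYPE('c)"
  unfolding all_proper_submodules_classical_def
proof (intro allI impI, elim conjE)
  fix M :: "('a, 'c) module" and P
  assume "module R M" and P: "submodule P R M" "P \<noteq> carrier M"
  interpret M: module R M by fact
  have "nonunits R \<subseteq> \<mm>"
    using nonunits_subset_square_zero_maximalideal assms
    by (simp add: local_ring_with_maximal_ideal_def)
  then have "a \<otimes> b = \<zero>" if "a \<in> nonunits R" "b \<in> nonunits R" for a b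
    using that ideal_prod.prod[of a \<mm> b \<mm> R] square by auto
  moreover have "\<zero>\<^bsub>M\<^esub> \<in> P"
    using subgroup.one_closed[OF submodule.axioms(1)[OF P(1)]] by simp
  ultimately show "classical_1_absorbing_prime_submodule P R M"
    using P unfolding classical_1_absorbing_prime_submodule_def by simp
qed

theorem all_classical_iff_square_zero_local:
  assumes nontrivial: "\<one> \<noteq> \<zero>"
  shows "all_proper_submodules_classical R TYPE('a) \<longleftrightarrow>
         (\<exists>\<mm>. local_ring_with_maximal_ideal R \<mm> \<and> ideal_prod R \<mm> \<mm> = {\<zero>})"
proof
  assume "all_proper_submodules_classical R TYPE('a)"
  note absorbing = all_proper_submodules_classical_imp_ideals[OF nontrivial this]
  have ideal: "ideal (nonunits R) R"
    by (rule ideal_nonunits[OF nontrivial nonunits_not_comaximal[OF absorbing]])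
  have "x = \<zero>" if "x \<in> ideal_prod R (nonunits R) (nonunits R)" for x
    using that by induction (auto simp: nonunits_mult_eq_zero[OF absorbing])
  moreover have "\<zero> \<in> ideal_prod R (nonunits R) (nonunits R)"
    using ideal_prod_is_ideal[OF ideal ideal] additive_subgroup.zero_closed ideal.axioms(1)
    by blast
  ultimately have "ideal_prod R (nonunits R) (nonunits R) = {\<zero>}" by blast
  then show "\<exists>\<mm>. local_ring_with_maximal_ideal R \<mm> \<and> ideal_prod R \<mm> \<mm> = {\<zero>}"
    using local_ring_nonunits[OF ideal] by blast
next
  assume "\<exists>\<mm>. local_ring_with_maximal_ideal R \<mm> \<and> ideal_prod R \<mm> \<mm> = {\<zero>}"
  then show "all_proper_submodules_classical R TYPE('a)"
    using square_zero_local_imp_all_classical by blast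
qed

end

theorem corollary2:
  fixes A :: "('a, 'r) ring_scheme" and I :: "'a set"
  assumes "cring A" and "\<one>\<^bsub>A\<^esub> \<noteq> \<zero>\<^bsub>A\<^esub>"
    and "ideal I A" and "I \<noteq> carrier A"
  shows "(classical_1_absorbing_prime_submodule I A (self_module A) \<longleftrightarrow>
            one_absorbing_prime_ideal I A) \<and>
         ((all_proper_submodules_classical A TYPE('a) \<and>
           all_proper_submodules_classical A TYPE('b)) \<longleftrightarrow>
            (\<exists>\<mm>. local_ring_with_maximal_ideal A \<mm> \<and>
                 ideal_prod A \<mm> \<mm> = {\<zero>\<^bsub>A\<^esub>}))"
proof -
  interpret cring A by fact
  show ?thesis
    using classical_self_module_iff[OF assms(3,4)]
      all_classical_iff_square_zero_local[OF assms(2)]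
      square_zero_local_imp_all_classical[where 'c = 'b]
    by blast
qed

end
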